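(* Let $V=\{1,\dots,n\}$, let $m\ge 1$ be an integer, and let $f:2^V\to\mathbb{R}$ be a normalized, monotone non-decreasing, submodular function. Run the algorithm GreedMax on $(f,m,V)$: initialize $A_1=\dots=A_m=\emptyset$ and $R=V$; while $R\neq\emptyset$, pick $j^*\in\arg\min_{j} f(A_j)$, pick $a^*\in\arg\max_{a\in R} f(a\mid A_{j^*})$, and set $A_{j^*}\leftarrow A_{j^*}\cup\{a^*\}$, $R\leftarrow R\setminus\{a^*\}$ (ties broken arbitrarily); output $\hat\pi=(A_1,\dots,A_m)$. Then $$\min_{i=1,\dots,m} f(A_i^{\hat\pi}) \ \ge\ \frac{1}{m}\max_{\pi\in\Pi}\ \min_{i=1,\dots,m} f(A_i^{\pi}).$$
   Context: $f$ is normalized if $f(\emptyset)=0$, monotone non-decreasing if $f(S)\le f(T)$ for $S\subseteq T$, and submodular if $f(S)+f(T)\ge f(S\cup T)+f(S\cap T)$ for all $S,T\subseteq V$. For $j\in V$, $S\subseteq V$, $f(j\mid S)=f(S\cup\{j\})-f(S)$. $\Pi$ denotes the set of all ordered partitions $\pi=(A_1^\pi,\dots,A_m^\pi)$ of $V$ into $m$ blocks, i.e. pairwise disjoint sets (possibly empty) whose union is $V$. *)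

theory Defs
  imports Complex_Main "HOL-Library.FuncSet" "HOL-Library.Disjoint_Sets"
begin

text \<open>
  A set function on the subsets of \<open>V\<close> is a total function \<open>f :: 'a set \<Rightarrow> real\<close>; only its values
  on subsets of \<open>V\<close> are constrained or used.
\<close>

definition normalized :: "('a set \<Rightarrow> real) \<Rightarrow> bool" where
  "normalized f \<longleftrightarrow> f {} = 0"

definition monotone_nondecreasing :: "'a set \<Rightarrow> ('a set \<Rightarrow> real) \<Rightarrow> bool" where
  "monotone_nondecreasing V f \<longleftrightarrow> (\<forall>S T. S \<subseteq> T \<and> T \<subseteq> V \<longrightarrow> f S \<le> f T)"

definition submodular :: "'a set \<Rightarrow> ('a set \<Rightarrow> real) \<Rightarrow> bool" where
  "submodular V f \<longleftrightarrow> (\<forall>S T. S \<subseteq> V \<and> T \<subseteq> V \<longrightarrow> f S + f T \<ge> f (S \<union> T) + f (S \<inter> T))"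

definition marginal :: "('a set \<Rightarrow> real) \<Rightarrow> 'a \<Rightarrow> 'a set \<Rightarrow> real" where
  "marginal f j S = f (S \<union> {j}) - f S"

text \<open>
  An \<open>m\<close>-tuple of blocks is a function on \<open>{1..m}\<close>, extended by \<open>undefined\<close> outside the index set
  so that distinct functions are distinct tuples. Blocks may be empty.
\<close>

definition ordered_partitions :: "nat \<Rightarrow> 'a set \<Rightarrow> (nat \<Rightarrow> 'a set) set" where
  "ordered_partitions m V =
     {\<pi> \<in> {1..m} \<rightarrow>\<^sub>E Pow V. disjoint_family_on \<pi> {1..m} \<and> (\<Union>i\<in>{1..m}. \<pi> i) = V}"

definition min_block_value :: "('a set \<Rightarrow> real) \<Rightarrow> nat \<Rightarrow> (nat \<Rightarrow> 'a set) \<Rightarrow> real" where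
  "min_block_value f m \<pi> = Min ((\<lambda>i. f (\<pi> i)) ` {1..m})"

text \<open>
  A state is a pair \<open>(A, R)\<close> of the current blocks and the remaining elements. The step is a
  relation rather than a function because ties are broken arbitrarily.
\<close>

inductive greedmax_step ::
  "('a set \<Rightarrow> real) \<Rightarrow> nat \<Rightarrow> (nat \<Rightarrow> 'a set) \<times> 'a set \<Rightarrow> (nat \<Rightarrow> 'a set) \<times> 'a set \<Rightarrow> bool"
  for f m where
  "\<lbrakk> R \<noteq> {};
     is_arg_min (\<lambda>i. f (A i)) (\<lambda>i. i \<in> {1..m}) j;
     is_arg_max (\<lambda>b. marginal f b (A j)) (\<lambda>b. b \<in> R) a \<rbrakk>
   \<Longrightarrow> greedmax_step f m (A, R) (A(j := A j \<union> {a}), R - {a})"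

definition greedmax_output :: "('a set \<Rightarrow> real) \<Rightarrow> nat \<Rightarrow> 'a set \<Rightarrow> (nat \<Rightarrow> 'a set) \<Rightarrow> bool" where
  "greedmax_output f m V A \<longleftrightarrow>
     (greedmax_step f m)\<^sup>*\<^sup>* (\<lambda>i\<in>{1..m}. {}, V) (A, {})"

lemma finite_ordered_partitions: "finite V \<Longrightarrow> finite (ordered_partitions m V)"
  by (rule finite_subset[of _ "{1..m} \<rightarrow>\<^sub>E Pow V"])
     (auto simp: ordered_partitions_def intro!: finite_PiE)

lemma ordered_partitions_nonempty:
  assumes "m \<ge> 1"
  shows "ordered_partitions m V \<noteq> {}"
proof -
  have "(\<lambda>i\<in>{1..m}. if i = 1 then V else {}) \<in> ordered_partitions m V"
    using assms by (auto simp: ordered_partitions_def disjoint_family_on_def split: if_splits)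
  then show ?thesis by blast
qed

lemma greedmax_reaches_end:
  assumes "m \<ge> 1" "finite R"
  shows "\<exists>B. (greedmax_step f m)\<^sup>*\<^sup>* (A, R) (B, {})"
  using assms(2)
proof (induction "card R" arbitrary: A R)
  case 0
  then show ?case by auto
next
  case (Suc k)
  have ne: "R \<noteq> {}" using Suc.hyps(2) by auto
  obtain j where j: "is_arg_min (\<lambda>i. f (A i)) (\<lambda>i. i \<in> {1..m}) j"
    using ex_is_arg_min_if_finite[of "{1..m}" "\<lambda>i. f (A i)"] assms(1) by auto
  obtain a where "is_arg_min (\<lambda>b. - marginal f b (A j)) (\<lambda>b. b \<in> R) a"
    using ex_is_arg_min_if_finite[OF Suc.prems ne] by blast
  then have a: "is_arg_max (\<lambda>b. marginal f b (A j)) (\<lambda>b. b \<in> R) a"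
    by (simp add: is_arg_min_def is_arg_max_def)
  have "a \<in> R" using a by (simp add: is_arg_max_def)
  then have "k = card (R - {a})" using Suc by simp
  from Suc.hyps(1)[OF this] Suc.prems
  obtain B where "(greedmax_step f m)\<^sup>*\<^sup>* (A(j := A j \<union> {a}), R - {a}) (B, {})"
    by blast
  with greedmax_step.intros[OF ne j a] show ?case
    by (meson converse_rtranclp_into_rtranclp)
qed

lemma greedmax_output_exists:
  "m \<ge> 1 \<Longrightarrow> finite V \<Longrightarrow> \<exists>A. greedmax_output f m V A"
  unfolding greedmax_output_def by (rule greedmax_reaches_end)

end

theory Submission
  imports Defs
begin

text \<open>
  Let \<open>\<beta>\<close> be the final minimum, attained at block \<open>i\<close>. The minimum never decreases and elements go
  only to a minimal block, so every other block is a set of value at most \<open>\<beta>\<close> plus at most one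
  element, its last. Dropping these at most \<open>m - 1\<close> last elements leaves a set \<open>U\<close> with
  \<open>f U \<le> m \<beta>\<close> by subadditivity. The \<open>m\<close> disjoint blocks of any other partition cannot all meet
  the dropped elements, so one of them lies in \<open>U\<close> and has value at most \<open>m \<beta>\<close>.
\<close>

lemma submodular_UN_le_sum:
  assumes norm: "normalized f" and mono: "monotone_nondecreasing V f" and sub: "submodular V f"
    and "finite I" and "\<And>i. i \<in> I \<Longrightarrow> B i \<subseteq> V"
  shows "f (\<Union>i\<in>I. B i) \<le> (\<Sum>i\<in>I. f (B i))"
  using assms(4,5)
proof (induction I rule: finite_induct)
  case empty
  then show ?case using norm by (simp add: normalized_def)
next
  case (insert x I)
  let ?U = "\<Union>i\<in>I. B i"
  have in_V: "B x \<subseteq> V" "?U \<subseteq> V" using insert.prems by auto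
  \<comment> \<open>Nonnegativity of the intersection term allows it to be dropped from the
    submodular inequality. This gives subadditivity for two sets, which is the induction
    step.\<close>
  have "f {} \<le> f (B x \<inter> ?U)"
    using mono in_V by (metis monotone_nondecreasing_def empty_subsetI le_infI1)
  then have "0 \<le> f (B x \<inter> ?U)"
    using norm by (simp add: normalized_def)
  moreover have "f (B x \<union> ?U) + f (B x \<inter> ?U) \<le> f (B x) + f ?U"
    using sub in_V by (simp add: submodular_def)
  ultimately show ?case using insert by simp
qed

text \<open>The intended \<open>B\<close> is the block before its last insertion and
  \<open>a\<close> the element then inserted. An inclusion in \<open>insert a B\<close> replaces an
  equation because a block that is still empty takes \<open>B = {}\<close> and any \<open>a\<close>.
  Comparing \<open>f B\<close> with the current values lets the bound be read off at the final
  state.\<close>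

definition greedmax_inv ::
  "('a set \<Rightarrow> real) \<Rightarrow> nat \<Rightarrow> 'a set \<Rightarrow> (nat \<Rightarrow> 'a set) \<times> 'a set \<Rightarrow> bool" where
  "greedmax_inv f m V = (\<lambda>(A, R).
     (\<Union>j\<in>{1..m}. A j) \<union> R = V \<and>
     (\<forall>j\<in>{1..m}. \<exists>B a. B \<subseteq> A j \<and> A j \<subseteq> insert a B \<and> (\<forall>i\<in>{1..m}. f B \<le> f (A i))))"

text \<open>By monotonicity no block value falls, so earlier witnesses stay valid. The block that
  grows gets a new witness, its old content, whose value was least among all blocks.\<close>

lemma greedmax_inv_step:
  assumes mono: "monotone_nondecreasing V f"
    and "greedmax_step f m s t" and "greedmax_inv f m V s"
  shows "greedmax_inv f m V t"
  using assms(2)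
proof cases
  case (1 R A j a)
  let ?A' = "A(j := A j \<union> {a})"
  have inv: "(\<Union>j\<in>{1..m}. A j) \<union> R = V"
    "\<forall>j\<in>{1..m}. \<exists>B a. B \<subseteq> A j \<and> A j \<subseteq> insert a B \<and> (\<forall>i\<in>{1..m}. f B \<le> f (A i))"
    using assms(3) 1(1) by (auto simp: greedmax_inv_def)
  have j: "j \<in> {1..m}" and j_min: "\<And>i. i \<in> {1..m} \<Longrightarrow> f (A j) \<le> f (A i)"
    using 1(4) by (auto simp: is_arg_min_linorder)
  have a: "a \<in> R" using 1(5) by (simp add: is_arg_max_def)
  have "A j \<union> {a} \<subseteq> V" using inv(1) a j by blast
  then have "f (A j) \<le> f (A j \<union> {a})"
    using mono by (metis monotone_nondecreasing_def Un_upper1)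
  then have grow: "f (A i) \<le> f (?A' i)" for i
    by simp
  have "(\<Union>k\<in>{1..m}. ?A' k) = (\<Union>k\<in>{1..m}. A k) \<union> {a}"
    using j by (auto split: if_splits)
  then have cover: "(\<Union>k\<in>{1..m}. ?A' k) \<union> (R - {a}) = V"
    using inv(1) a by blast
  have "\<exists>B b. B \<subseteq> ?A' k \<and> ?A' k \<subseteq> insert b B \<and> (\<forall>i\<in>{1..m}. f B \<le> f (?A' i))"
    if k: "k \<in> {1..m}" for k
  proof (cases "k = j")
    case True
    have "\<forall>i\<in>{1..m}. f (A j) \<le> f (?A' i)"
      using j_min grow by (metis order_trans)
    then show ?thesis
      using True by (intro exI[of _ "A j"] exI[of _ a]) auto
  next
    case False
    obtain B b where B: "B \<subseteq> A k" "A k \<subseteq> insert b B" "\<forall>i\<in>{1..m}. f B \<le> f (A i)"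
      using bspec[OF inv(2) k] by (elim exE conjE)
    have "\<forall>i\<in>{1..m}. f B \<le> f (?A' i)"
      by (intro ballI order_trans[OF _ grow] bspec[OF B(3)])
    then show ?thesis
      using False B(1,2) by (intro exI[of _ B] exI[of _ b]) auto
  qed
  with cover show ?thesis
    unfolding 1(2) greedmax_inv_def prod.case by (intro conjI ballI)
qed

lemma greedmax_output_inv:
  assumes "monotone_nondecreasing V f" and "greedmax_output f m V A"
  shows "greedmax_inv f m V (A, {})"
proof -
  \<comment> \<open>At the start all blocks are empty, so \<open>B = {}\<close> serves for each of
    them.\<close>
  have "greedmax_inv f m V (\<lambda>i\<in>{1..m}. {}, V)"
    by (auto simp: greedmax_inv_def)
  with assms(2)[unfolded greedmax_output_def] show ?thesis
    by (induction rule: rtranclp_induct) (auto intro: greedmax_inv_step[OF assms(1)])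
qed

text \<open>Pigeonhole: if every \<open>P i\<close> met \<open>D\<close>, choosing a common point
  for each index would, by disjointness, embed \<open>I\<close> into \<open>D\<close>.\<close>

lemma disjoint_family_on_avoids_small_set:
  assumes "finite D" and "card D < card I" and "disjoint_family_on P I"
  shows "\<exists>i\<in>I. P i \<inter> D = {}"
proof (rule ccontr)
  assume "\<not> ?thesis"
  then have "\<forall>i\<in>I. \<exists>x. x \<in> P i \<inter> D" by blast
  then obtain x where x: "\<And>i. i \<in> I \<Longrightarrow> x i \<in> P i \<inter> D" by metis
  have "inj_on x I"
    using x assms(3) by (fastforce simp: inj_on_def disjoint_family_on_def)
  moreover have "x ` I \<subseteq> D" using x by blast
  ultimately have "card I \<le> card D"
    using assms(1) card_inj_on_le by blast
  then show False using assms(2) by simp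
qed

lemma greedmax_ge_partition:
  assumes norm: "normalized f" and mono: "monotone_nondecreasing V f" and sub: "submodular V f"
    and m: "m \<ge> 1" and out: "greedmax_output f m V A" and P: "P \<in> ordered_partitions m V"
  shows "min_block_value f m P \<le> real m * min_block_value f m A"
proof -
  have inv: "(\<Union>j\<in>{1..m}. A j) = V"
    "\<forall>j\<in>{1..m}. \<exists>B a. B \<subseteq> A j \<and> A j \<subseteq> insert a B \<and> (\<forall>i\<in>{1..m}. f B \<le> f (A i))"
    using greedmax_output_inv[OF mono out] by (auto simp: greedmax_inv_def)
  obtain B where "\<forall>j\<in>{1..m}. \<exists>a. B j \<subseteq> A j \<and> A j \<subseteq> insert a (B j) \<and>
      (\<forall>i\<in>{1..m}. f (B j) \<le> f (A i))"
    using bchoice[OF inv(2)] by (elim exE)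
  from bchoice[OF this] obtain a where
    "\<forall>j\<in>{1..m}. B j \<subseteq> A j \<and> A j \<subseteq> insert (a j) (B j) \<and> (\<forall>i\<in>{1..m}. f (B j) \<le> f (A i))"
    by (elim exE)
  then have
    B: "\<And>j. j \<in> {1..m} \<Longrightarrow> B j \<subseteq> A j \<and> A j \<subseteq> insert (a j) (B j) \<and> (\<forall>i\<in>{1..m}. f (B j) \<le> f (A i))"
    by (rule bspec)
  have "Min ((\<lambda>i. f (A i)) ` {1..m}) \<in> (\<lambda>i. f (A i)) ` {1..m}"
    using m by (intro Min_in) auto
  then obtain i where i: "i \<in> {1..m}" and min: "min_block_value f m A = f (A i)"
    by (auto simp: min_block_value_def)
  \<comment> \<open>Block \<open>i\<close> stays whole: its value is the minimum itself, so only the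
    other blocks have to give up an element.\<close>
  define C where "C = B(i := A i)"
  define U where "U = (\<Union>j\<in>{1..m}. C j)"
  define D where "D = a ` ({1..m} - {i})"
  have C: "C j \<subseteq> V" "f (C j) \<le> f (A i)" if "j \<in> {1..m}" for j
    using B[OF that] inv(1) i that by (auto simp: C_def)
  have "f U \<le> (\<Sum>j\<in>{1..m}. f (C j))"
    unfolding U_def using C(1) by (intro submodular_UN_le_sum[OF norm mono sub]) auto
  also have "\<dots> \<le> real m * f (A i)"
    using sum_bounded_above[of "{1..m}" "\<lambda>j. f (C j)" "f (A i)"] C(2) by simp
  finally have U: "f U \<le> real m * f (A i)" .
  have "V \<subseteq> U \<union> D"
  proof
    fix x assume "x \<in> V"
    then obtain j where j: "j \<in> {1..m}" "x \<in> A j" using inv(1) by blast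
    show "x \<in> U \<union> D"
    proof (cases "j = i")
      case True
      then show ?thesis using j by (auto simp: U_def C_def)
    next
      case False
      then have "x = a j \<or> x \<in> C j" using B[OF j(1)] j(2) by (auto simp: C_def)
      then show ?thesis using j(1) False by (auto simp: U_def D_def)
    qed
  qed
  \<comment> \<open>Leaving out \<open>i\<close> bounds the size of \<open>D\<close> by
    \<open>m - 1\<close>, which yields the strict inequality for the pigeonhole argument over
    \<open>m\<close> blocks.\<close>
  have "card D \<le> card ({1..m} - {i})"
    unfolding D_def by (intro card_image_le) simp
  also have "\<dots> < card {1..m}"
    using i by (intro card_Diff1_less) auto
  finally obtain k where k: "k \<in> {1..m}" "P k \<inter> D = {}"
    using disjoint_family_on_avoids_small_set[of D "{1..m}" P] P
    by (auto simp: D_def ordered_partitions_def)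
  have "P k \<subseteq> V" using P k(1) by (auto simp: ordered_partitions_def)
  then have "P k \<subseteq> U" using k(2) \<open>V \<subseteq> U \<union> D\<close> by blast
  moreover have "U \<subseteq> V" unfolding U_def using C(1) by blast
  ultimately have "f (P k) \<le> f U" using mono by (simp add: monotone_nondecreasing_def)
  moreover have "min_block_value f m P \<le> f (P k)"
    unfolding min_block_value_def using k(1) by (intro Min_le) auto
  ultimately show ?thesis using U min by simp
qed

theorem theorem2:
  fixes n m :: nat and V :: "nat set" and f :: "nat set \<Rightarrow> real" and A :: "nat \<Rightarrow> nat set"
  assumes "V = {1..n}"
    and "m \<ge> 1"
    and "normalized f"
    and "monotone_nondecreasing V f"
    and "submodular V f"
    and "greedmax_output f m V A"
  shows "min_block_value f m A \<ge>
           1 / real m * Max (min_block_value f m ` ordered_partitions m V)"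
proof -
  \<comment> \<open>With the factor \<open>1 / real m\<close> cleared, the maximum can be bounded
    one partition at a time.\<close>
  have "Max (min_block_value f m ` ordered_partitions m V) \<le> real m * min_block_value f m A"
  proof (rule Max.boundedI)
    show "finite (min_block_value f m ` ordered_partitions m V)"
      using assms(1) by (simp add: finite_ordered_partitions)
    show "min_block_value f m ` ordered_partitions m V \<noteq> {}"
      using ordered_partitions_nonempty[OF assms(2)] by blast
    show "x \<le> real m * min_block_value f m A"
      if "x \<in> min_block_value f m ` ordered_partitions m V" for x
      using that by (elim imageE) (simp only: greedmax_ge_partition[OF assms(3-5,2,6)])
  qed
  then show ?thesis
    using assms(2) by (simp add: divide_le_eq mult.commute)
qed

end
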